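(* Let $F$ be an order complete vector lattice and let $(E_n)$ be a filtration on $F$. Then the space $\mathcal{M}_r=\mathcal{M}_r\bigl(F,(E_n)\bigr)$ of regular martingales, equipped with the coordinate-wise order, is an order complete vector lattice.
   Context: Let $F$ be a vector lattice. A filtration on $F$ is a sequence $(E_n)_{n\in\mathbb{N}}$ of positive (linear) projections on $F$ such that $E_nE_m=E_{n\wedge m}$ for all $n,m$, where $n\wedge m=\min(n,m)$. No further assumptions (e.g. order continuity) are made on the $E_n$. A sequence $X=(x_n)$ in $F$ is a martingale with respect to $(E_n)$ if $E_nx_m=x_n$ whenever $m\ge n$. The vector space of all martingales is denoted $\mathcal{M}=\mathcal{M}\bigl(F,(E_n)\bigr)$; it is ordered coordinate-wise ($X\le Y$ iff $x_n\le y_n$ for all $n$), with positive cone $\mathcal{M}_+$. The space of regular martingales is $\mathcal{M}_r=\{X_1-X_2 : X_1,X_2\in\mathcal{M}_+\}$ with the order inherited from $\mathcal{M}$. Order complete means that every non-empty subset that is bounded above has a supremum. *)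

theory Defs
  imports Complex_Main "HOL-Library.Function_Algebras" "HOL-Library.Lub_Glb"
begin

instantiation "fun" :: (type, real_vector) real_vector
begin

definition scaleR_fun :: "real \<Rightarrow> ('a \<Rightarrow> 'b) \<Rightarrow> 'a \<Rightarrow> 'b"
  where "scaleR_fun c f = (\<lambda>i. c *\<^sub>R f i)"

instance
  by standard
    (simp_all add: scaleR_fun_def fun_eq_iff scaleR_add_right scaleR_add_left)

end

instance "fun" :: (type, ordered_real_vector) ordered_real_vector
  by standard
    (simp_all add: scaleR_fun_def le_fun_def scaleR_left_mono scaleR_right_mono)

(* The notions below are relative to a carrier V, ordered as a subset of the ambient
   space: bounds are required to lie in V, and a supremum in V need not be one in the
   ambient space. For V = UNIV they are the notions for the whole type. *)

definition vector_lattice :: "'a::ordered_real_vector set \<Rightarrow> bool"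
  where "vector_lattice V \<longleftrightarrow>
    subspace V \<and>
    (\<forall>x\<in>V. \<forall>y\<in>V. (\<exists>s. isLub V {x, y} s) \<and> (\<exists>i. isGlb V {x, y} i))"

definition order_complete :: "'a::order set \<Rightarrow> bool"
  where "order_complete V \<longleftrightarrow>
    (\<forall>A\<subseteq>V. A \<noteq> {} \<longrightarrow> (\<exists>u. isUb V A u) \<longrightarrow> (\<exists>s. isLub V A s))"

definition order_complete_vector_lattice :: "'a::ordered_real_vector set \<Rightarrow> bool"
  where "order_complete_vector_lattice V \<longleftrightarrow> vector_lattice V \<and> order_complete V"

lemma order_complete_vector_lattice_UNIV:
  "order_complete_vector_lattice
     (UNIV :: 'a::{ordered_real_vector, conditionally_complete_lattice} set)"
proof -
  have "isLub UNIV {x, y} (sup x y)" and "isGlb UNIV {x, y} (inf x y)" for x y :: 'a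
    by (simp_all add: isLub_def isGlb_def leastP_def greatestP_def isUb_def isLb_def
        setle_def setge_def)
  moreover have "isLub UNIV A (Sup A)" if "A \<noteq> {}" "isUb UNIV A u" for A and u :: 'a
  proof -
    have "bdd_above A"
      using that by (auto simp: isUb_def setle_def intro: bdd_aboveI)
    then show ?thesis
      using that
      by (auto simp: isLub_def leastP_def isUb_def setle_def setge_def
          intro: cSup_upper cSup_least)
  qed
  ultimately show ?thesis
    unfolding order_complete_vector_lattice_def vector_lattice_def order_complete_def
    by (blast intro: subspace_UNIV)
qed

definition positive_projection :: "('a::ordered_real_vector \<Rightarrow> 'a) \<Rightarrow> bool"
  where "positive_projection P \<longleftrightarrow>
    linear P \<and> (\<forall>x. P (P x) = P x) \<and> (\<forall>x. 0 \<le> x \<longrightarrow> 0 \<le> P x)"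

definition filtration :: "(nat \<Rightarrow> 'a::ordered_real_vector \<Rightarrow> 'a) \<Rightarrow> bool"
  where "filtration E \<longleftrightarrow>
    (\<forall>n. positive_projection (E n)) \<and> (\<forall>n m. E n \<circ> E m = E (min n m))"

(* Sequences carry the pointwise operations and the pointwise (coordinate-wise) order of
   the function type. *)

definition martingales :: "(nat \<Rightarrow> 'a::ordered_real_vector \<Rightarrow> 'a) \<Rightarrow> (nat \<Rightarrow> 'a) set"
  where "martingales E = {X. \<forall>n m. n \<le> m \<longrightarrow> E n (X m) = X n}"

definition positive_martingales ::
    "(nat \<Rightarrow> 'a::ordered_real_vector \<Rightarrow> 'a) \<Rightarrow> (nat \<Rightarrow> 'a) set"
  where "positive_martingales E = {X \<in> martingales E. 0 \<le> X}"

definition regular_martingales ::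
    "(nat \<Rightarrow> 'a::ordered_real_vector \<Rightarrow> 'a) \<Rightarrow> (nat \<Rightarrow> 'a) set"
  where "regular_martingales E =
    {X1 - X2 | X1 X2. X1 \<in> positive_martingales E \<and> X2 \<in> positive_martingales E}"

end

(* The pointwise supremum of a set of martingales is only a submartingale, and without order
   continuity of the projections the Doob-type limit sup_m (E_n y_m) is again only a
   submartingale.  Instead, given a non-empty set A of regular martingales bounded above, let Z
   be the pointwise supremum of all submartingales lying below every upper bound of A in the
   regular martingales.  Then Z is the largest such submartingale.  The sequence n |-> E_n z_(n+1)
   is another one, and it dominates Z, so it equals Z; hence Z is a martingale, and it is the
   supremum of A. *)

theory Submission
  imports Defs
begin

section \<open>Suprema and infima relative to a carrier\<close>

lemma isLub_iff: "isLub V A s \<longleftrightarrow>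
    s \<in> V \<and> (\<forall>x\<in>A. x \<le> s) \<and> (\<forall>u\<in>V. (\<forall>x\<in>A. x \<le> u) \<longrightarrow> s \<le> u)"
  by (auto simp: isLub_def leastP_def isUb_def setle_def setge_def)

lemma isGlb_iff: "isGlb V A i \<longleftrightarrow>
    i \<in> V \<and> (\<forall>x\<in>A. i \<le> x) \<and> (\<forall>l\<in>V. (\<forall>x\<in>A. l \<le> x) \<longrightarrow> l \<le> i)"
  by (auto simp: isGlb_def greatestP_def isLb_def setle_def setge_def)

text \<open>Negation reverses the order and maps the subspace \<open>V\<close> onto itself, so it
  exchanges least upper and greatest lower bounds relative to \<open>V\<close>.\<close>

lemma isGlb_uminus:
  fixes V :: "'a::ordered_real_vector set"
  assumes "subspace V" and "isLub V (uminus ` A) s"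
  shows "isGlb V A (- s)"
proof -
  have "s \<le> - l" if "l \<in> V" "\<forall>x\<in>A. l \<le> x" for l
    using assms(2) that subspace_neg[OF assms(1)] unfolding isLub_iff by force
  moreover have "- s \<le> x" if "x \<in> A" for x
    using assms(2) that unfolding isLub_iff by (auto intro: minus_le_iff[THEN iffD1])
  ultimately show ?thesis
    using assms(2) subspace_neg[OF assms(1)] unfolding isGlb_iff isLub_iff
    by (simp add: le_minus_iff)
qed

lemma order_completeD:
  assumes "order_complete V" and "A \<subseteq> V" and "A \<noteq> {}" and "u \<in> V" and "\<And>x. x \<in> A \<Longrightarrow> x \<le> u"
  shows "\<exists>s. isLub V A s"
  using assms unfolding order_complete_def isUb_def setle_def by blast

text \<open>Directedness makes every pair bounded above in \<open>V\<close>, so completeness yields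
  its supremum, and negation turns this into infima. No formula for the supremum of two elements is
  called for.\<close>

lemma order_complete_vector_latticeI:
  fixes V :: "'a::ordered_real_vector set"
  assumes "subspace V" and "order_complete V"
    and "\<And>x y. x \<in> V \<Longrightarrow> y \<in> V \<Longrightarrow> \<exists>u\<in>V. x \<le> u \<and> y \<le> u"
  shows "order_complete_vector_lattice V"
proof -
  have sup: "\<exists>s. isLub V {x, y} s" if xy: "x \<in> V" "y \<in> V" for x y
  proof -
    obtain u where "u \<in> V" "x \<le> u" "y \<le> u"
      using assms(3) xy by blast
    then show ?thesis
      using xy by (intro order_completeD[OF assms(2), of "{x, y}" u]) auto
  qed
  have "\<exists>i. isGlb V {x, y} i" if "x \<in> V" "y \<in> V" for x y
    using sup[of "- x" "- y"] that subspace_neg[OF assms(1)]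
      isGlb_uminus[OF assms(1), of "{x, y}"] by auto
  then show ?thesis
    using sup assms(1,2)
    by (simp add: order_complete_vector_lattice_def vector_lattice_def)
qed

section \<open>Filtrations and martingales\<close>

lemma positive_projection_mono:
  assumes "positive_projection P" and "x \<le> y"
  shows "P x \<le> P y"
proof -
  have "0 \<le> P (y - x)"
    using assms by (simp add: positive_projection_def)
  also have "P (y - x) = P y - P x"
    using assms(1) by (simp add: positive_projection_def linear_diff)
  finally show ?thesis
    by simp
qed

lemma filtration_linear: "filtration E \<Longrightarrow> linear (E n)"
  by (simp add: filtration_def positive_projection_def)

lemma filtration_mono: "filtration E \<Longrightarrow> x \<le> y \<Longrightarrow> E n x \<le> E n y"
  by (simp add: filtration_def positive_projection_mono)

lemma filtration_tower:
  assumes "filtration E" and "n \<le> m"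
  shows "E n (E m x) = E n x"
proof -
  have "E n \<circ> E m = E (min n m)"
    using assms(1) by (simp add: filtration_def)
  then show ?thesis
    using assms(2) by (simp add: fun_eq_iff min_def)
qed

lemma martingalesD: "X \<in> martingales E \<Longrightarrow> n \<le> m \<Longrightarrow> E n (X m) = X n"
  by (simp add: martingales_def)

text \<open>By the tower property,
  \<open>E n (X m) = E n (E m (X (Suc m))) = E n (X (Suc m))\<close>, so the value stays the same as
  \<open>m\<close> grows.\<close>

lemma martingalesI_Suc:
  assumes "filtration E" and step: "\<And>n. E n (X (Suc n)) = X n"
  shows "X \<in> martingales E"
proof -
  have "E n (X m) = X n" if "n \<le> m" for n m
    using that
  proof (induction m rule: dec_induct)
    \<comment> \<open>\<open>E n (X n) = X n\<close> is not automatic: it holds because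
      \<open>X n = E n (X (Suc n))\<close> lies in the range of the projection
      \<open>E n\<close>.\<close>
    case base
    then show ?case
      using filtration_tower[OF assms(1) order_refl, of n "X (Suc n)"] by (simp add: step)
  next
    case (step m)
    then show ?case
      using filtration_tower[OF assms(1), of n m "X (Suc m)"] assms(2) by simp
  qed
  then show ?thesis
    by (simp add: martingales_def)
qed

lemma subspace_martingales:
  assumes "filtration E"
  shows "subspace (martingales E)"
  using filtration_linear[OF assms]
  by (auto simp: subspace_def martingales_def linear_0 linear_add linear_scale
      scaleR_fun_def)

lemma positive_martingales_add:
  assumes "filtration E" and "X \<in> positive_martingales E" and "Y \<in> positive_martingales E"
  shows "X + Y \<in> positive_martingales E"
  using assms subspace_add[OF subspace_martingales[OF assms(1)]]
  by (simp add: positive_martingales_def)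

lemma positive_martingales_scaleR:
  assumes "filtration E" and "X \<in> positive_martingales E" and "0 \<le> c"
  shows "c *\<^sub>R X \<in> positive_martingales E"
  using assms subspace_scale[OF subspace_martingales[OF assms(1)]]
  by (simp add: positive_martingales_def scaleR_nonneg_nonneg)

section \<open>Regular martingales\<close>

lemma regular_martingalesI:
  "X1 \<in> positive_martingales E \<Longrightarrow> X2 \<in> positive_martingales E \<Longrightarrow>
    X = X1 - X2 \<Longrightarrow> X \<in> regular_martingales E"
  by (auto simp: regular_martingales_def)

lemma regular_martingalesE:
  assumes "X \<in> regular_martingales E"
  obtains X1 X2 where "X1 \<in> positive_martingales E" "X2 \<in> positive_martingales E" "X = X1 - X2"
  using assms by (auto simp: regular_martingales_def)

lemma regular_martingales_subset:
  assumes "filtration E"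
  shows "regular_martingales E \<subseteq> martingales E"
  using subspace_diff[OF subspace_martingales[OF assms]]
  by (auto simp: regular_martingales_def positive_martingales_def)

lemma positive_martingales_subset_regular:
  assumes "filtration E"
  shows "positive_martingales E \<subseteq> regular_martingales E"
proof
  fix X assume "X \<in> positive_martingales E"
  moreover have "0 \<in> positive_martingales E"
    using subspace_0[OF subspace_martingales[OF assms]] by (simp add: positive_martingales_def)
  ultimately show "X \<in> regular_martingales E"
    by (rule regular_martingalesI) simp
qed

lemma subspace_regular_martingales:
  assumes "filtration E"
  shows "subspace (regular_martingales E)"
  unfolding subspace_def
proof (intro conjI ballI allI)
  have "0 \<in> positive_martingales E"
    using subspace_0[OF subspace_martingales[OF assms]] by (simp add: positive_martingales_def)
  then show "0 \<in> regular_martingales E"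
    using positive_martingales_subset_regular[OF assms] by blast
next
  fix X Y assume "X \<in> regular_martingales E" "Y \<in> regular_martingales E"
  then obtain X1 X2 Y1 Y2 where
    "X1 \<in> positive_martingales E" "X2 \<in> positive_martingales E" "X = X1 - X2"
    "Y1 \<in> positive_martingales E" "Y2 \<in> positive_martingales E" "Y = Y1 - Y2"
    by (elim regular_martingalesE) blast
  then show "X + Y \<in> regular_martingales E"
    by (intro regular_martingalesI[of "X1 + Y1" _ "X2 + Y2"])
      (simp_all add: positive_martingales_add[OF assms])
next
  fix c :: real and X assume "X \<in> regular_martingales E"
  then obtain X1 X2 where
    X: "X1 \<in> positive_martingales E" "X2 \<in> positive_martingales E" "X = X1 - X2"
    by (rule regular_martingalesE)
  show "c *\<^sub>R X \<in> regular_martingales E"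
  proof (cases "0 \<le> c")
    case True
    with X show ?thesis
      by (intro regular_martingalesI[of "c *\<^sub>R X1" _ "c *\<^sub>R X2"])
        (simp_all add: positive_martingales_scaleR[OF assms] scaleR_diff_right)
  next
    \<comment> \<open>A negative scalar swaps the roles of the two positive martingales.\<close>
    case False
    with X show ?thesis
      by (intro regular_martingalesI[of "(- c) *\<^sub>R X2" _ "(- c) *\<^sub>R X1"])
        (simp_all add: positive_martingales_scaleR[OF assms] scaleR_diff_right
          del: scaleR_minus_left, simp)
  qed
qed

text \<open>\<open>Z\<close> is \<open>X\<close> plus the positive martingale \<open>Z - X\<close>.
  This reduces regularity of a supremum to its being a martingale, since it lies above a regular
  one.\<close>

lemma regular_martingales_upward_closed:
  assumes "filtration E" and "X \<in> regular_martingales E" and "Z \<in> martingales E" and "X \<le> Z"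
  shows "Z \<in> regular_martingales E"
proof -
  have "Z - X \<in> positive_martingales E"
    using assms regular_martingales_subset[OF assms(1)]
    by (auto simp: positive_martingales_def intro: subspace_diff[OF subspace_martingales])
  then have "X + (Z - X) \<in> regular_martingales E"
    using assms(2) positive_martingales_subset_regular[OF assms(1)]
    by (blast intro: subspace_add[OF subspace_regular_martingales[OF assms(1)]])
  then show ?thesis
    by simp
qed

text \<open>The bound is \<open>X1 + Y1\<close>, the sum of the positive parts of chosen
  decompositions; dropping \<open>X2\<close> and \<open>Y2\<close> and adding a positive martingale
  only increases.\<close>

lemma regular_martingales_directed:
  assumes "filtration E" and "X \<in> regular_martingales E" and "Y \<in> regular_martingales E"
  shows "\<exists>U\<in>regular_martingales E. X \<le> U \<and> Y \<le> U"
proof -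
  obtain X1 X2 Y1 Y2 where XY:
    "X1 \<in> positive_martingales E" "X2 \<in> positive_martingales E" "X = X1 - X2"
    "Y1 \<in> positive_martingales E" "Y2 \<in> positive_martingales E" "Y = Y1 - Y2"
    using assms(2,3) by (elim regular_martingalesE) blast
  then have "X1 + Y1 \<in> regular_martingales E"
    using positive_martingales_add[OF assms(1)] positive_martingales_subset_regular[OF assms(1)]
    by blast
  moreover have "X1 - X2 \<le> X1 + Y1" "Y1 - Y2 \<le> X1 + Y1"
  proof -
    have "X1 \<le> X1 + (X2 + Y1)" "Y1 \<le> Y1 + (X1 + Y2)"
      using XY by (simp_all add: positive_martingales_def)
    then show "X1 - X2 \<le> X1 + Y1" "Y1 - Y2 \<le> X1 + Y1"
      by (simp_all only: diff_le_eq ac_simps)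
  qed
  ultimately show ?thesis
    using XY by blast
qed

section \<open>Submartingales\<close>

text \<open>For \<open>n = m\<close> only \<open>Y n \<le> E n (Y n)\<close> is asked, not equality:
  a supremum of elements of the range of \<open>E n\<close>, taken in the whole space, may leave
  that range.\<close>

definition submartingales :: "(nat \<Rightarrow> 'a::ordered_real_vector \<Rightarrow> 'a) \<Rightarrow> (nat \<Rightarrow> 'a) set"
  where "submartingales E = {Y. \<forall>n m. n \<le> m \<longrightarrow> Y n \<le> E n (Y m)}"

lemma martingales_subset_submartingales: "martingales E \<subseteq> submartingales E"
  by (simp add: martingales_def submartingales_def subset_iff)

text \<open>A positive operator satisfies only one inequality for suprema, that of the images being
  at most the image of the supremum. This is the direction that a submartingale needs.\<close>

lemma submartingales_isLub:
  assumes "filtration E" and "S \<subseteq> submartingales E"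
    and Z: "\<And>n. isLub UNIV ((\<lambda>Y. Y n) ` S) (Z n)"
  shows "Z \<in> submartingales E"
proof -
  have "Z n \<le> E n (Z m)" if "n \<le> m" for n m
  proof -
    have "Y n \<le> E n (Z m)" if "Y \<in> S" for Y
    proof -
      have "Y n \<le> E n (Y m)"
        using assms(2) \<open>Y \<in> S\<close> \<open>n \<le> m\<close> by (auto simp: submartingales_def)
      also have "\<dots> \<le> E n (Z m)"
        using Z[of m] \<open>Y \<in> S\<close> by (intro filtration_mono[OF assms(1)]) (simp add: isLub_iff)
      finally show ?thesis .
    qed
    then show ?thesis
      using Z[of n] by (simp add: isLub_iff)
  qed
  then show ?thesis
    by (simp add: submartingales_def)
qed

text \<open>Apply \<open>E n\<close> to \<open>Y (Suc n) \<le> E (Suc n) (Y (Suc m))\<close>; the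
  tower property lets \<open>E m\<close> replace \<open>E (Suc n)\<close> under
  \<open>E n\<close>.\<close>

lemma submartingales_shift:
  assumes "filtration E" and "Y \<in> submartingales E"
  shows "(\<lambda>n. E n (Y (Suc n))) \<in> submartingales E"
proof -
  have "E n (Y (Suc n)) \<le> E n (E m (Y (Suc m)))" if "n \<le> m" for n m
  proof -
    have "E n (Y (Suc n)) \<le> E n (E (Suc n) (Y (Suc m)))"
      using assms(2) that by (intro filtration_mono[OF assms(1)]) (simp add: submartingales_def)
    also have "\<dots> = E n (E m (Y (Suc m)))"
      using that by (simp add: filtration_tower[OF assms(1)])
    finally show ?thesis .
  qed
  then show ?thesis
    by (simp add: submartingales_def)
qed

section \<open>Order completeness\<close>

lemma order_complete_regular_martingales:
  fixes E :: "nat \<Rightarrow> 'a::ordered_real_vector \<Rightarrow> 'a"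
  assumes complete: "order_complete (UNIV :: 'a set)" and E: "filtration E"
  shows "order_complete (regular_martingales E)"
  unfolding order_complete_def
proof (intro allI impI)
  fix A :: "(nat \<Rightarrow> 'a) set"
  assume A: "A \<subseteq> regular_martingales E" "A \<noteq> {}" and "\<exists>U. isUb (regular_martingales E) A U"
  define B where "B = {W \<in> regular_martingales E. \<forall>X\<in>A. X \<le> W}"
  define S where "S = {Y \<in> submartingales E. \<forall>W\<in>B. Y \<le> W}"
  obtain U where "U \<in> B"
    using \<open>\<exists>U. _\<close> by (auto simp: B_def isUb_def setle_def)
  obtain X where "X \<in> A"
    using A(2) by blast
  \<comment> \<open>Hence \<open>S\<close> is non-empty and everything above all of \<open>S\<close>
    is above \<open>A\<close>. Each coordinate of \<open>S\<close> is bounded by that of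
    \<open>U\<close>, so \<open>Z\<close> exists.\<close>
  have "A \<subseteq> S"
    using A(1) regular_martingales_subset[OF E] martingales_subset_submartingales
    by (fastforce simp: S_def B_def)
  have "\<exists>z. isLub UNIV ((\<lambda>Y. Y n) ` S) z" for n
  proof -
    have "(\<lambda>Y. Y n) ` S \<noteq> {}"
      using \<open>A \<subseteq> S\<close> A(2) by blast
    moreover have "Y n \<le> U n" if "Y \<in> S" for Y
      using that \<open>U \<in> B\<close> by (simp add: S_def le_fun_def)
    ultimately show ?thesis
      by (intro order_completeD[OF complete, of _ "U n"]) auto
  qed
  then obtain Z where Z: "isLub UNIV ((\<lambda>Y. Y n) ` S) (Z n)" for n
    by metis
  have Z_upper: "Y \<le> Z" if "Y \<in> S" for Y
    using Z that by (simp add: isLub_iff le_fun_def)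
  have "Z \<in> submartingales E"
    by (rule submartingales_isLub[OF E _ Z]) (auto simp: S_def)
  moreover have Z_le: "Z \<le> W" if "W \<in> B" for W
  proof (rule le_funI)
    fix n
    have "Y n \<le> W n" if "Y \<in> S" for Y
      using that \<open>W \<in> B\<close> by (simp add: S_def le_fun_def)
    then show "Z n \<le> W n"
      using Z[of n] by (simp add: isLub_iff)
  qed
  \<comment> \<open>The shift is monotone and fixes the martingale \<open>W\<close>, so it preserves
    lying below \<open>W\<close>.\<close>
  moreover have "(\<lambda>n. E n (Z (Suc n))) \<le> W" if "W \<in> B" for W
  proof (rule le_funI)
    fix n
    have "E n (Z (Suc n)) \<le> E n (W (Suc n))"
      using Z_le[OF that] by (intro filtration_mono[OF E]) (simp add: le_fun_def)
    also have "\<dots> = W n"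
      using that regular_martingales_subset[OF E] by (intro martingalesD) (auto simp: B_def)
    finally show "E n (Z (Suc n)) \<le> W n" .
  qed
  ultimately have "(\<lambda>n. E n (Z (Suc n))) \<in> S"
    using submartingales_shift[OF E] by (simp add: S_def)
  \<comment> \<open>Maximality of \<open>Z\<close> in \<open>S\<close> gives this half; the other is
    the submartingale inequality from \<open>n\<close> to \<open>Suc n\<close>.\<close>
  then have "E n (Z (Suc n)) \<le> Z n" for n
    using Z_upper by (auto simp: le_fun_def)
  moreover have "Z n \<le> E n (Z (Suc n))" for n
    using \<open>Z \<in> submartingales E\<close> by (simp add: submartingales_def)
  ultimately have "Z \<in> martingales E"
    by (intro martingalesI_Suc[OF E] order.antisym)
  then have "Z \<in> regular_martingales E"
    using \<open>X \<in> A\<close> A(1) \<open>A \<subseteq> S\<close> Z_upper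
    by (blast intro: regular_martingales_upward_closed[OF E, of X])
  \<comment> \<open>\<open>Z\<close> is least because every upper bound of \<open>A\<close> among
    the regular martingales belongs to \<open>B\<close>.\<close>
  then have "isLub (regular_martingales E) A Z"
    using \<open>A \<subseteq> S\<close> Z_upper Z_le by (auto simp: isLub_iff B_def)
  then show "\<exists>s. isLub (regular_martingales E) A s"
    by blast
qed

theorem theorem1p1:
  fixes E :: "nat \<Rightarrow> 'a::ordered_real_vector \<Rightarrow> 'a"
  assumes "order_complete_vector_lattice (UNIV :: 'a set)"
    and "filtration E"
  shows "order_complete_vector_lattice (regular_martingales E)"
proof (rule order_complete_vector_latticeI)
  show "order_complete (regular_martingales E)"
    using assms
    by (simp add: order_complete_vector_lattice_def order_complete_regular_martingales)
qed (use assms(2) in \<open>simp_all add: subspace_regular_martingales regular_martingales_directed\<close>)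

end
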